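(* If $X$ is any (non-empty) regular space, then $$\min\{\Delta(X),\,\mathrm{w}(X)\}\le 2^{\mathrm{pd}(X)}.$$
   Context: Regular spaces are assumed to be Hausdorff ($T_3$). For a topological space $X$ with topology $\tau_X$, a neighborhood assignment on $X$ is a map $U:X\to\tau_X$ with $x\in U(x)$ for all $x\in X$. A set $A\subseteq X$ pins down $U$ if $A\cap U(x)\neq\emptyset$ for all $x\in X$. The pinning down number $\mathrm{pd}(X)$ is the smallest cardinal $\kappa$ such that every neighborhood assignment on $X$ can be pinned down by a subset of $X$ of size $\kappa$. The dispersion character $\Delta(X)$ is the smallest cardinality of a non-empty open subset of $X$. $\mathrm{w}(X)$ is the weight of $X$ (the smallest cardinality of a base). *)

theory Defs
  imports "HOL-Analysis.Analysis"
begin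

unbundle cardinal_syntax

text \<open>
  Cardinals are represented as in the library, by relations \<open>r\<close> with \<open>Card_order r\<close>, where
  \<open>=o\<close> is equality and \<open>\<le>o\<close> is the ordering of cardinals (possibly over different types).
  The choice below is unique up to \<open>=o\<close>. The least cardinal is taken among cardinals whose field
  consists of elements of type \<open>'b\<close>; all uses below pick \<open>'b\<close> large enough for the least cardinal
  in question to be represented.
\<close>

definition least_cardinal :: "('b rel \<Rightarrow> bool) \<Rightarrow> 'b rel" where
  "least_cardinal P =
     (SOME \<kappa>. Card_order \<kappa> \<and> P \<kappa> \<and> (\<forall>\<mu>. Card_order \<mu> \<and> P \<mu> \<longrightarrow> \<kappa> \<le>o \<mu>))"

text \<open>The minimum of two cardinals, tagged like \<open>+c\<close> since the two may live over different types.\<close>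

definition cmin :: "'a rel \<Rightarrow> 'b rel \<Rightarrow> ('a + 'b) rel" where
  "cmin r s = (if r \<le>o s then |Inl ` Field r| else |Inr ` Field s| )"

definition neighborhood_assignment :: "'a topology \<Rightarrow> ('a \<Rightarrow> 'a set) \<Rightarrow> bool" where
  "neighborhood_assignment X U \<longleftrightarrow> (\<forall>x\<in>topspace X. openin X (U x) \<and> x \<in> U x)"

definition pins_down :: "'a topology \<Rightarrow> 'a set \<Rightarrow> ('a \<Rightarrow> 'a set) \<Rightarrow> bool" where
  "pins_down X A U \<longleftrightarrow> A \<subseteq> topspace X \<and> (\<forall>x\<in>topspace X. A \<inter> U x \<noteq> {})"

definition pinning_down_number :: "'a topology \<Rightarrow> 'a rel" where
  "pinning_down_number X =
     least_cardinal (\<lambda>\<kappa>. \<forall>U. neighborhood_assignment X U \<longrightarrow> (\<exists>A. |A| =o \<kappa> \<and> pins_down X A U))"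

definition dispersion_character :: "'a topology \<Rightarrow> 'a rel" where
  "dispersion_character X =
     least_cardinal (\<lambda>\<kappa>. \<exists>V. openin X V \<and> V \<noteq> {} \<and> |V| =o \<kappa>)"

definition weight :: "'a topology \<Rightarrow> 'a set rel" where
  "weight X =
     least_cardinal (\<lambda>\<kappa>. \<exists>\<B>. openin X = arbitrary union_of (\<lambda>V. V \<in> \<B>) \<and> |\<B>| =o \<kappa>)"

lemma least_cardinal:
  assumes "Card_order \<mu>" "P \<mu>"
  shows "Card_order (least_cardinal P) \<and> P (least_cardinal P) \<and>
         (\<forall>\<mu>. Card_order \<mu> \<and> P \<mu> \<longrightarrow> least_cardinal P \<le>o \<mu>)"
proof -
  have "\<exists>\<kappa>\<in>{\<kappa>. Card_order \<kappa> \<and> P \<kappa>}. \<forall>\<mu>\<in>{\<kappa>. Card_order \<kappa> \<and> P \<kappa>}. \<kappa> \<le>o \<mu>"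
    using assms by (intro exists_minim_Card_order) auto
  then have "\<exists>\<kappa>. Card_order \<kappa> \<and> P \<kappa> \<and> (\<forall>\<mu>. Card_order \<mu> \<and> P \<mu> \<longrightarrow> \<kappa> \<le>o \<mu>)"
    by blast
  then show ?thesis
    unfolding least_cardinal_def by (rule someI_ex)
qed

lemma cmin_eq:
  assumes "Card_order r" "Card_order s"
  shows "cmin r s =o r \<and> r \<le>o s \<or> cmin r s =o s \<and> s \<le>o r"
proof -
  have l: "|Inl ` Field r :: ('a + 'b) set| =o r"
    by (rule ordIso_transitive[OF ordIso_symmetric card_of_Field_ordIso[OF assms(1)]])
       (rule card_of_ordIsoI[of Inl], simp add: bij_betw_def)
  have r: "|Inr ` Field s :: ('a + 'b) set| =o s"
    by (rule ordIso_transitive[OF ordIso_symmetric card_of_Field_ordIso[OF assms(2)]])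
       (rule card_of_ordIsoI[of Inr], simp add: bij_betw_def)
  have "r \<le>o s \<or> s \<le>o r"
    using assms ordLeq_total unfolding card_order_on_def by blast
  with l r show ?thesis
    unfolding cmin_def by auto
qed

lemma pinning_down_number:
  "Card_order (pinning_down_number X)"
  "neighborhood_assignment X U \<Longrightarrow> \<exists>A. |A| =o pinning_down_number X \<and> pins_down X A U"
  "(\<And>U. neighborhood_assignment X U \<Longrightarrow> \<exists>A. |A| =o (\<mu> :: 'c rel) \<and> pins_down X A U)
     \<Longrightarrow> pinning_down_number X \<le>o \<mu>"
proof -
  let ?P = "\<lambda>\<kappa>::'a rel. \<forall>U. neighborhood_assignment X U \<longrightarrow> (\<exists>A. |A| =o \<kappa> \<and> pins_down X A U)"
  have "?P |topspace X|"
    by (auto simp: neighborhood_assignment_def pins_down_def intro!: exI[of _ "topspace X"] card_of_refl)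
  note * = least_cardinal[of _ ?P, OF card_of_Card_order this, folded pinning_down_number_def]
  show "Card_order (pinning_down_number X)"
    "neighborhood_assignment X U \<Longrightarrow> \<exists>A. |A| =o pinning_down_number X \<and> pins_down X A U"
    using * by blast+
  show "pinning_down_number X \<le>o \<mu>"
    if \<mu>: "\<And>U. neighborhood_assignment X U \<Longrightarrow> \<exists>A. |A| =o \<mu> \<and> pins_down X A U"
  proof -
    have "neighborhood_assignment X (\<lambda>_. topspace X)"
      by (simp add: neighborhood_assignment_def)
    from \<mu>[OF this] obtain B :: "'a set" where B: "|B| =o \<mu>"
      by blast
    have "?P |B|"
      using \<mu> ordIso_transitive[OF _ ordIso_symmetric[OF B]] by meson
    then have "pinning_down_number X \<le>o |B|"
      using * card_of_Card_order by blast
    then show ?thesis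
      using B by (rule ordLeq_ordIso_trans)
  qed
qed

lemma dispersion_character:
  assumes "topspace X \<noteq> {}"
  shows "Card_order (dispersion_character X)"
    and "\<exists>V. openin X V \<and> V \<noteq> {} \<and> |V| =o dispersion_character X"
    and "\<lbrakk>openin X V; V \<noteq> {}\<rbrakk> \<Longrightarrow> dispersion_character X \<le>o |V|"
proof -
  let ?P = "\<lambda>\<kappa>::'a rel. \<exists>V. openin X V \<and> V \<noteq> {} \<and> |V| =o \<kappa>"
  have P: "?P |V|" if "openin X V" "V \<noteq> {}" for V
    using that card_of_refl by blast
  note * = least_cardinal[of _ ?P, OF card_of_Card_order P[OF openin_topspace assms],
      folded dispersion_character_def]
  show "Card_order (dispersion_character X)"
    "\<exists>V. openin X V \<and> V \<noteq> {} \<and> |V| =o dispersion_character X"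
    using * by blast+
  show "dispersion_character X \<le>o |V|" if "openin X V" "V \<noteq> {}"
    using * P[OF that] card_of_Card_order by blast
qed

lemma weight:
  "Card_order (weight X)"
  "\<exists>\<B>. openin X = arbitrary union_of (\<lambda>V. V \<in> \<B>) \<and> |\<B>| =o weight X"
  "openin X = arbitrary union_of (\<lambda>V. V \<in> \<B>) \<Longrightarrow> weight X \<le>o |\<B>|"
proof -
  let ?P = "\<lambda>\<kappa>::'a set rel. \<exists>\<B>. openin X = arbitrary union_of (\<lambda>V. V \<in> \<B>) \<and> |\<B>| =o \<kappa>"
  have P: "?P |\<B>|" if "openin X = arbitrary union_of (\<lambda>V. V \<in> \<B>)" for \<B>
    using that card_of_refl by blast
  have "openin X = arbitrary union_of (\<lambda>V. V \<in> {V. openin X V})"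
    by (auto simp: fun_eq_iff union_of_def arbitrary_def)
  note * = least_cardinal[of _ ?P, OF card_of_Card_order P[OF this], folded weight_def]
  show "Card_order (weight X)"
    "\<exists>\<B>. openin X = arbitrary union_of (\<lambda>V. V \<in> \<B>) \<and> |\<B>| =o weight X"
    using * by blast+
  show "weight X \<le>o |\<B>|" if "openin X = arbitrary union_of (\<lambda>V. V \<in> \<B>)"
    using * P[OF that] card_of_Card_order by blast
qed

end

theory Submission
  imports Defs
begin

text \<open>
  Let \<open>\<kappa>\<close> be the pinning down number and suppose that \<open>2\<^sup>\<kappa>\<close> is smaller than both the dispersion
  character and the weight. The interiors of closed sets form a base of a regular space, so there
  is a family of \<open>(2\<^sup>\<kappa>)\<^sup>+\<close> of them. All non-empty differences \<open>G - cl H\<close> of members can be given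
  distinct representatives, since their number does not exceed the dispersion character; so some
  set \<open>A\<close> of size \<open>\<kappa>\<close> meets all these differences. Then the members of the family have distinct
  traces on \<open>A\<close>, so there are at most \<open>2\<^sup>\<kappa>\<close> of them.
\<close>

text \<open>Transfinite recursion along the cardinal well-order \<open>|I|\<close>: before stage
  \<open>i\<close> fewer than \<open>|I|\<close> points have been used, so they cannot exhaust
  \<open>B i\<close> and a fresh point can be chosen.\<close>

lemma distinct_representatives:
  fixes B :: "'i \<Rightarrow> 'a set"
  assumes le: "\<And>i. i \<in> I \<Longrightarrow> |I| \<le>o |B i|"
  obtains f where "inj_on f I" "\<And>i. i \<in> I \<Longrightarrow> f i \<in> B i"
proof -
  interpret wo_rel "|I|"
    using card_of_Well_order by (simp add: wo_rel_def)
  define H where "H = (\<lambda>(f::'i \<Rightarrow> 'a) i. SOME x. x \<in> B i - f ` underS i)"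
  define f where "f = worec H"
  have "adm_wo H"
    unfolding adm_wo_def H_def
  proof (intro allI impI)
    fix f g :: "'i \<Rightarrow> 'a" and i assume "\<forall>j\<in>underS i. f j = g j"
    then have "f ` underS i = g ` underS i"
      by (intro image_cong) auto
    then show "(SOME x. x \<in> B i - f ` underS i) = (SOME x. x \<in> B i - g ` underS i)"
      by simp
  qed
  then have f: "f i = (SOME x. x \<in> B i - f ` underS i)" for i
    using fun_cong[OF worec_fixpoint[of H], of i] by (simp add: f_def H_def)
  have fi: "f i \<in> B i - f ` underS i" if "i \<in> I" for i
  proof -
    have "|f ` underS i| \<le>o |underS i|"
      by (rule card_of_image)
    also have "|underS i| <o |I|"
      using card_of_underS[OF card_of_Card_order, of i I] that by (simp add: Field_card_of)
    also have "|I| \<le>o |B i|"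
      by (rule le[OF that])
    finally have "|f ` underS i| <o |B i|" .
    then have "\<not> B i \<subseteq> f ` underS i"
      using card_of_mono1 not_ordLess_ordLeq by blast
    then have "\<exists>x. x \<in> B i - f ` underS i"
      by blast
    then show ?thesis
      by (subst f) (rule someI_ex)
  qed
  have "f i \<noteq> f j" if "i \<in> I" "j \<in> I" "i \<noteq> j" for i j
  proof -
    have "i \<in> underS j \<or> j \<in> underS i"
      using TOTALS that by (auto simp: underS_def Field_card_of)
    then show ?thesis
      using fi[OF that(1)] fi[OF that(2)] by (metis DiffD2 imageI)
  qed
  then have "inj_on f I"
    by (auto simp: inj_on_def)
  with fi show ?thesis
    using that by blast
qed

text \<open>Pinning down controls one neighborhood per point. Distinct representatives extend this
  to a whole family, by making each \<open>B i\<close> the neighborhood of its own point.\<close>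

lemma pin_family:
  fixes B :: "'i \<Rightarrow> 'a set"
  assumes "\<And>i. i \<in> I \<Longrightarrow> openin X (B i)"
    and "\<And>i. i \<in> I \<Longrightarrow> |I| \<le>o |B i|"
  obtains A where "|A| =o pinning_down_number X" "A \<subseteq> topspace X" "\<And>i. i \<in> I \<Longrightarrow> A \<inter> B i \<noteq> {}"
proof -
  obtain f where f: "inj_on f I" "\<And>i. i \<in> I \<Longrightarrow> f i \<in> B i"
    using distinct_representatives[of I B] assms(2) by blast
  \<comment> \<open>Injectivity of \<open>f\<close> makes the value at \<open>f i\<close>
    unambiguous; elsewhere the whole space is a harmless default.\<close>
  define U where "U x = (if x \<in> f ` I then B (the_inv_into I f x) else topspace X)" for x
  have U: "U (f i) = B i" if "i \<in> I" for i
    using that f(1) by (simp add: U_def the_inv_into_f_f)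
  have "openin X (U x) \<and> x \<in> U x" if "x \<in> topspace X" for x
  proof (cases "x \<in> f ` I")
    case True
    then show ?thesis
      using U assms(1) f(2) by auto
  next
    case False
    then show ?thesis
      using that by (simp add: U_def)
  qed
  then have "neighborhood_assignment X U"
    by (simp add: neighborhood_assignment_def)
  from pinning_down_number(2)[OF this]
  obtain A where A: "|A| =o pinning_down_number X" "pins_down X A U"
    by blast
  have "A \<inter> B i \<noteq> {}" if "i \<in> I" for i
  proof -
    have "f i \<in> topspace X"
      using f(2) assms(1) that openin_subset by blast
    then have "A \<inter> U (f i) \<noteq> {}"
      using A(2) by (simp add: pins_down_def)
    then show ?thesis
      by (simp add: U that)
  qed
  then show ?thesis
    using A that by (simp add: pins_down_def)
qed

text \<open>Regularity puts a closed neighborhood of each point of \<open>W\<close> inside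
  \<open>W\<close>. Basic sets of this form are determined by their closures, which later turns
  inclusion in a closure into inclusion in the set itself.\<close>

lemma regular_space_interior_base:
  assumes "regular_space X"
  shows "openin X = arbitrary union_of (\<lambda>V. V \<in> {X interior_of C |C. closedin X C})"
proof (rule ext, rule iffI)
  fix W assume W: "openin X W"
  let ?\<U> = "{X interior_of C |C. closedin X C \<and> C \<subseteq> W}"
  have "W \<subseteq> \<Union>?\<U>"
  proof
    fix x assume "x \<in> W"
    with W assms obtain U C where UC: "openin X U" "closedin X C" "x \<in> U" "U \<subseteq> C" "C \<subseteq> W"
      unfolding neighbourhood_base_of_closedin[symmetric] neighbourhood_base_of by metis
    then have "x \<in> X interior_of C"
      using interior_of_maximal by blast
    with UC show "x \<in> \<Union>?\<U>"
      by blast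
  qed
  moreover have "\<Union>?\<U> \<subseteq> W"
    using interior_of_subset by fastforce
  ultimately have "\<Union>?\<U> = W"
    by blast
  then show "(arbitrary union_of (\<lambda>V. V \<in> {X interior_of C |C. closedin X C})) W"
    unfolding union_of_def arbitrary_def by (intro exI[of _ ?\<U>]) auto
next
  fix W assume "(arbitrary union_of (\<lambda>V. V \<in> {X interior_of C |C. closedin X C})) W"
  then show "openin X W"
    unfolding union_of_def by (auto intro!: openin_Union)
qed

lemma finite_open_imp_isolated:
  assumes "t1_space X" "openin X V" "finite V" "x \<in> V"
  shows "openin X {x}"
proof -
  have "V - {x} \<subseteq> topspace X"
    using assms openin_subset by blast
  then have "closedin X (V - {x})"
    using assms t1_space_closedin_finite by blast
  then have "openin X (V - (V - {x}))"
    using assms(2) by (rule openin_diff[rotated])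
  moreover have "V - (V - {x}) = {x}"
    using assms(4) by blast
  ultimately show ?thesis
    by simp
qed

text \<open>A finite non-empty open set would contain an isolated point, so the dispersion character
  would be at most 1 and could not exceed the nonzero cardinal \<open>r\<close>.\<close>

lemma infinite_open_if_dispersed:
  assumes "t1_space X" "topspace X \<noteq> {}"
    and r: "Card_order r" "Field r \<noteq> {}" "r <o dispersion_character X"
    and V: "openin X V" "V \<noteq> {}"
  shows "infinite V"
proof
  assume "finite V"
  obtain x where "x \<in> V"
    using V by blast
  with assms \<open>finite V\<close> have "openin X {x}"
    by (blast intro: finite_open_imp_isolated)
  then have "dispersion_character X \<le>o |{x}|"
    using dispersion_character(3)[OF assms(2)] by blast
  also have "|{x}| \<le>o |Field r|"
    using r(2) by (simp add: card_of_singl_ordLeq)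
  also have "|Field r| =o r"
    by (rule card_of_Field_ordIso[OF r(1)])
  finally show False
    using r(3) not_ordLess_ordLeq by blast
qed

lemma card_pairs_ordLeq:
  assumes "|K| \<le>o |V|" "infinite V"
  shows "|K \<times> K| \<le>o |V|"
proof -
  have "|K \<times> K| \<le>o |V \<times> K|"
    by (rule card_of_Times_mono1[OF assms(1)])
  also have "|V \<times> K| \<le>o |V \<times> V|"
    by (rule card_of_Times_mono2[OF assms(1)])
  also have "|V \<times> V| =o |V|"
    by (rule card_of_Times_same_infinite[OF assms(2)])
  finally show ?thesis .
qed

lemma separated_interiors_bound:
  fixes G :: "'k \<Rightarrow> 'a set"
  assumes "inj_on G K"
    and G: "\<And>k. k \<in> K \<Longrightarrow> \<exists>C. closedin X C \<and> G k = X interior_of C"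
    and big: "\<And>V. openin X V \<Longrightarrow> V \<noteq> {} \<Longrightarrow> |K \<times> K| \<le>o |V|"
  shows "|K| \<le>o ctwo ^c pinning_down_number X"
proof -
  define B where "B = (\<lambda>(i, j). G i - X closure_of (G j))"
  \<comment> \<open>Only non-empty differences are kept, since \<open>big\<close> bounds only
    non-empty open sets from below.\<close>
  define I where "I = {p \<in> K \<times> K. B p \<noteq> {}}"
  have opn: "openin X (G k)" if "k \<in> K" for k
    using G[OF that] by auto
  have B: "openin X (B p)" if "p \<in> I" for p
    using that opn by (auto simp: I_def B_def)
  have "|I| \<le>o |B p|" if "p \<in> I" for p
  proof -
    have "|I| \<le>o |K \<times> K|"
      by (rule card_of_mono1) (auto simp: I_def)
    also have "|K \<times> K| \<le>o |B p|"
      using big[OF B[OF that]] that by (simp add: I_def)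
    finally show ?thesis .
  qed
  with B obtain A where A: "|A| =o pinning_down_number X" "A \<subseteq> topspace X"
    "\<And>p. p \<in> I \<Longrightarrow> A \<inter> B p \<noteq> {}"
    using pin_family[of I X B] by blast
  \<comment> \<open>Equal traces keep \<open>A\<close> away from \<open>B (i, j)\<close>, which must
    then be empty, so \<open>G i\<close> lies in the closure of \<open>G j\<close>. That closure
    lies in the closed set \<open>C\<close>, and the open set \<open>G i\<close> therefore lies in
    the interior of \<open>C\<close>, which is \<open>G j\<close>.\<close>
  have sub: "G i \<subseteq> G j" if ij: "i \<in> K" "j \<in> K" and tr: "A \<inter> G i = A \<inter> G j" for i j
  proof -
    have "G j \<subseteq> X closure_of (G j)"
      using opn[OF ij(2)] by (simp add: closure_of_subset openin_subset)
    then have "A \<inter> B (i, j) = {}"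
      using tr by (auto simp: B_def)
    then have "(i, j) \<notin> I"
      using A(3) by blast
    then have "G i \<subseteq> X closure_of (G j)"
      using ij by (auto simp: I_def B_def)
    moreover obtain C where C: "closedin X C" "G j = X interior_of C"
      using G[OF ij(2)] by blast
    ultimately have "G i \<subseteq> C"
      using closure_of_minimal[of "G j" C X] interior_of_subset[of X C] by auto
    then show ?thesis
      using C opn[OF ij(1)] interior_of_maximal by blast
  qed
  have "inj_on (\<lambda>k. A \<inter> G k) K"
  proof (rule inj_onI)
    fix i j assume "i \<in> K" "j \<in> K" "A \<inter> G i = A \<inter> G j"
    then have "G i = G j"
      using sub[of i j] sub[of j i] by simp
    then show "i = j"
      using assms(1) \<open>i \<in> K\<close> \<open>j \<in> K\<close> by (simp add: inj_on_eq_iff)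
  qed
  then have "|K| \<le>o |Pow A|"
    by (intro card_of_ordLeqI[of "\<lambda>k. A \<inter> G k"]) auto
  also have "|Pow A| =o ctwo ^c |A|"
    using card_of_Pow_Func by (simp add: cexp_def ctwo_def Field_card_of)
  also have "ctwo ^c |A| =o ctwo ^c pinning_down_number X"
    by (rule cexp_cong2[OF A(1) Card_order_ctwo card_of_Card_order])
  finally show ?thesis .
qed

theorem theorem4p7:
  fixes X :: "'a topology"
  assumes "topspace X \<noteq> {}"
    and "regular_space X"
    and "Hausdorff_space X"
  shows "cmin (dispersion_character X) (weight X) \<le>o ctwo ^c pinning_down_number X"
proof (rule ccontr)
  let ?m = "ctwo ^c pinning_down_number X"
  \<comment> \<open>The successor is small enough to be bounded by both the dispersion character and
    the weight, yet already too large for \<open>separated_interiors_bound\<close>.\<close>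
  let ?\<theta> = "cardSuc ?m"
  note \<Delta> = dispersion_character[OF assms(1)]
  have m: "Card_order ?m"
    by (rule Card_order_cexp)
  have c: "cmin (dispersion_character X) (weight X) =o dispersion_character X \<and>
      dispersion_character X \<le>o weight X \<or>
      cmin (dispersion_character X) (weight X) =o weight X \<and> weight X \<le>o dispersion_character X"
    by (rule cmin_eq[OF \<Delta>(1) weight(1)])
  have "Well_order (cmin (dispersion_character X) (weight X))"
    by (simp add: cmin_def card_of_Well_order)
  moreover assume "\<not> cmin (dispersion_character X) (weight X) \<le>o ?m"
  ultimately have "?m <o cmin (dispersion_character X) (weight X)"
    using m not_ordLeq_iff_ordLess card_order_on_well_order_on by blast
  with c have lt: "?m <o dispersion_character X" "?m <o weight X"
    by (meson ordLess_ordIso_trans ordLess_ordLeq_trans)+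
  let ?R = "{X interior_of C |C. closedin X C}"
  have \<theta>: "|Field ?\<theta>| =o ?\<theta>"
    by (rule card_of_Field_ordIso) (rule cardSuc_Card_order[OF m])
  have "?\<theta> \<le>o weight X"
    using lt(2) m weight(1) cardSuc_ordLess_ordLeq by blast
  also have "weight X \<le>o |?R|"
    by (rule weight(3)[OF regular_space_interior_base[OF assms(2)]])
  finally have "|Field ?\<theta>| \<le>o |?R|"
    using \<theta> ordIso_ordLeq_trans by blast
  then obtain G where G: "inj_on G (Field ?\<theta>)" "G ` Field ?\<theta> \<subseteq> ?R"
    unfolding card_of_ordLeq[symmetric] by blast
  \<comment> \<open>Since \<open>?m\<close> is at least 1, the dispersion character exceeds 1 and
    non-empty open sets are infinite; hence passing from indices to pairs of indices costs
    nothing.\<close>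
  have "Field ?m \<noteq> {}"
    by (auto simp: cexp_def ctwo_def Field_card_of Func_is_emp)
  then have "|Field ?\<theta> \<times> Field ?\<theta>| \<le>o |V|" if "openin X V" "V \<noteq> {}" for V
  proof (intro card_pairs_ordLeq)
    have "?\<theta> \<le>o dispersion_character X"
      using lt(1) m \<Delta>(1) cardSuc_ordLess_ordLeq by blast
    also have "dispersion_character X \<le>o |V|"
      by (rule \<Delta>(3)[OF that])
    finally show "|Field ?\<theta>| \<le>o |V|"
      using \<theta> ordIso_ordLeq_trans by blast
  qed (use infinite_open_if_dispersed[OF Hausdorff_imp_t1_space[OF assms(3)] assms(1) m _ lt(1)] that
      in blast)
  then have "|Field ?\<theta>| \<le>o ?m"
    using G by (intro separated_interiors_bound[of G]) auto
  then have "?\<theta> \<le>o ?m"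
    using \<theta> ordIso_ordLeq_trans ordIso_symmetric by blast
  then show False
    using cardSuc_greater[OF m] not_ordLess_ordLeq by blast
qed

end
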